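(* Let $m\ge 1$ be an integer. Define $p_0=1$, $p_1=2m$, $q_0=0$, $q_1=1$ and, for $j\ge 1$, $$p_{2j}=mp_{2j-1}+p_{2j-2},\quad p_{2j+1}=4mp_{2j}+p_{2j-1},\quad q_{2j}=mq_{2j-1}+q_{2j-2},\quad q_{2j+1}=4mq_{2j}+q_{2j-1}.$$ Then for all integers $k\ge 1$ and $n\ge 1$, $$\sqrt{(q_{k+1}n)^2+p_{k+1}n+m^2+1}=\left[q_{k+1}n+m;\ \overline{\underbrace{2m,\dots,2m}_{k\text{ times}},\ 2(q_{k+1}n+m)}\right].$$
   Context: $[a_0;\overline{a_1,\dots,a_\ell}]$ denotes the value of the infinite simple continued fraction $a_0+\cfrac{1}{a_1+\cfrac{1}{a_2+\dotsb}}$ with first partial quotient $a_0$, after which the block $a_1,\dots,a_\ell$ of positive integers is repeated indefinitely. The fractions $p_j/q_j$ ($j\ge1$) are the convergents of $\sqrt{(2m)^2+4}=[2m;\overline{m,4m}]$. *)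

theory Defs
  imports Complex_Main
begin

text \<open>Value of the finite continued fraction $[a_0; a_1, \dots, a_N]$.\<close>
primrec cfrac_fin :: "nat \<Rightarrow> (nat \<Rightarrow> int) \<Rightarrow> real" where
  "cfrac_fin 0 a = of_int (a 0)"
| "cfrac_fin (Suc N) a = of_int (a 0) + 1 / cfrac_fin N (\<lambda>i. a (Suc i))"

text \<open>
  The infinite simple continued fraction $[a_0; a_1, a_2, \dots]$ has value $x$: all partial
  quotients after the first are positive, so that no denominator in \<open>cfrac_fin\<close> vanishes, and
  the finite truncations converge to $x$.
\<close>
definition has_cfrac_value :: "(nat \<Rightarrow> int) \<Rightarrow> real \<Rightarrow> bool" where
  "has_cfrac_value a x \<longleftrightarrow>
     (\<forall>i\<ge>1. a i > 0) \<and> (\<lambda>N. cfrac_fin N a) \<longlonglongrightarrow> x"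

text \<open>
  The partial quotients $a_0, \overline{b_1, \dots, b_\ell}$; meaningful only for a nonempty
  block \<open>bs\<close>. The list is indexed from 0, the block starts at position 1.
\<close>
definition periodic_pq :: "int \<Rightarrow> int list \<Rightarrow> nat \<Rightarrow> int" where
  "periodic_pq a0 bs i = (if i = 0 then a0 else bs ! ((i - 1) mod length bs))"

end

theory Submission
  imports Defs
begin

text \<open>
  Write $A = q_{k+1} n + m$, $N$ for the radicand and $x = \sqrt N$. The expansion claimed for $x$
  says that the complete quotient $y = 1/(x - A)$ equals $[2m, \dots, 2m, 2A + 1/y]$ with $k$ entries
  $2m$, and here $2A + 1/y = x + A$. If $U_0 = 0$, $U_1 = 1$, $U_{j+2} = 2m U_{j+1} + U_j$ are the
  continuants of the constant sequence $2m$ (lemma \<open>cfrac_tail_replicate\<close>), this equation is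
  \[ \frac{1}{x - A} = \frac{U_{k+1} (x + A) + U_k}{U_k (x + A) + U_{k-1}}, \]
  which, after clearing denominators, has no irrational part left:
  $U_{k+1} (N - A^2) = 2 A U_k + U_{k-1}$.
  Inserting $A$ and $N$, the coefficients of $n$ on both sides agree exactly if
  $p_{k+1} U_{k+1} = 2 q_{k+1} (U_k + m U_{k+1})$, and the constant terms agree by the recurrence
  of $U$. The relation between $p$ and $q$ holds because
  $\sqrt{(2m)^2 + 4} = 2 \sqrt{m^2 + 1}$: the recurrence with alternating coefficients $m, 4m$ is the
  recurrence of $U$ with all terms of one parity halved (lemma \<open>convergents_continuants\<close>).

  It remains to see that a real number whose complete quotients reproduce the given partial
  quotients is the limit of the finite continued fractions. This follows from a contraction
  estimate (lemma \<open>cfrac_fin_error\<close>), transferred to periodic sequences in lemma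
  \<open>has_cfrac_value_periodic\<close>.
\<close>

section \<open>Complete quotients determine the value\<close>

lemma cfrac_fin_ge_1:
  assumes "\<And>i. a i \<ge> 1"
  shows "cfrac_fin N a \<ge> 1"
  using assms
proof (induction N arbitrary: a)
  case 0
  then show ?case by simp
next
  case (Suc N)
  have "cfrac_fin N (\<lambda>i. a (Suc i)) \<ge> 1" by (intro Suc.IH Suc.prems)
  moreover have "of_int (a 0) \<ge> (1::real)" using Suc.prems[of 0] by simp
  ultimately show ?case by (simp add: add_increasing2)
qed

lemma complete_quotient_ge_1:
  fixes a :: "nat \<Rightarrow> int" and t :: "nat \<Rightarrow> real"
  assumes "\<And>i. i \<ge> 1 \<Longrightarrow> a i \<ge> 1"
    and "\<And>i. t i = of_int (a i) + 1 / t (Suc i)"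
    and "\<And>i. i \<ge> 1 \<Longrightarrow> t i > 0"
    and "i \<ge> 1"
  shows "t i \<ge> 1"
proof -
  have "of_int (a i) \<ge> (1::real)" using assms(1,4) by simp
  moreover have "1 / t (Suc i) > 0" using assms(3)[of "Suc i"] by simp
  ultimately show ?thesis using assms(2)[of i] by linarith
qed

text \<open>
  One step multiplies the error by $1/(c\,t)$, where $c$ is the truncated and $t$ the true complete
  quotient. A single step need not contract, as both factors may be close to 1. Two consecutive
  complete quotients, however, have a product of the form $(b + 1/s) s = b s + 1 \ge 2$, so two
  steps gain a factor 4.
\<close>
lemma cfrac_fin_error:
  fixes a :: "nat \<Rightarrow> int" and t :: "nat \<Rightarrow> real"
  assumes "\<And>i. i \<ge> 1 \<Longrightarrow> a i \<ge> 1"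
    and "\<And>i. t i = of_int (a i) + 1 / t (Suc i)"
    and "\<And>i. i \<ge> 1 \<Longrightarrow> t i > 0"
  shows "\<bar>cfrac_fin N a - t 0\<bar> \<le> 1 / 2 ^ N"
  using assms
proof (induction N arbitrary: a t rule: induct_nat_012)
  case 0
  have "t 1 \<ge> 1" by (rule complete_quotient_ge_1[of a t, OF 0(1-3)]) auto
  moreover have "cfrac_fin 0 a - t 0 = - (1 / t 1)" using 0(2)[of 0] by simp
  ultimately show ?case by simp
next
  case 1
  define b s where "b = real_of_int (a 1)" and "s = t 2"
  have s: "s \<ge> 1" unfolding s_def by (rule complete_quotient_ge_1[of a t, OF 1(1-3)]) auto
  have b: "b \<ge> 1" using 1(1)[of 1] by (simp add: b_def)
  have t1: "t 1 = b + 1 / s" using 1(2)[of 1] by (simp add: b_def s_def numeral_2_eq_2)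
  have bs: "b * s + 1 \<ge> 2" using mult_mono[of 1 b 1 s] b s by simp
  have "cfrac_fin (Suc 0) a - t 0 = 1 / b - 1 / (b + 1 / s)"
    using 1(2)[of 0] t1 by (simp add: b_def)
  also have "\<dots> = 1 / b - s / (b * s + 1)"
    using s by (simp add: add_divide_eq_iff)
  also have "\<dots> = 1 / (b * (b * s + 1))"
    using b s bs by (simp add: diff_frac_eq algebra_simps)
  finally have eq: "cfrac_fin (Suc 0) a - t 0 = 1 / (b * (b * s + 1))" .
  have "b * (b * s + 1) \<ge> 2" using mult_mono[of 1 b 2 "b * s + 1"] b bs by simp
  then show ?case unfolding eq by (simp add: divide_simps)
next
  case (ge2 N)
  define c b s where "c = cfrac_fin N (\<lambda>i. a (Suc (Suc i)))"
    and "b = real_of_int (a 1)" and "s = t 2"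
  have s: "s \<ge> 1" unfolding s_def by (rule complete_quotient_ge_1[of a t, OF ge2(3-5)]) auto
  have c: "c \<ge> 1" unfolding c_def by (rule cfrac_fin_ge_1) (use ge2(3) in auto)
  have b: "b \<ge> 1" using ge2(3)[of 1] by (simp add: b_def)
  have bs: "b * s + 1 \<ge> 2" using mult_mono[of 1 b 1 s] b s by simp
  have bc: "b * c + 1 \<ge> 2" using mult_mono[of 1 b 1 c] b c by simp
  have t1: "t 1 = b + 1 / s" using ge2(4)[of 1] by (simp add: b_def s_def numeral_2_eq_2)
  have IH: "\<bar>c - s\<bar> \<le> 1 / 2 ^ N"
  proof -
    have "\<bar>cfrac_fin N (\<lambda>i. a (Suc (Suc i))) - t (Suc (Suc 0))\<bar> \<le> 1 / 2 ^ N"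
    proof (rule ge2(1))
      show "t (Suc (Suc i)) = of_int (a (Suc (Suc i))) + 1 / t (Suc (Suc (Suc i)))" for i
        by (rule ge2(4))
    qed (auto intro: ge2(3,5))
    then show ?thesis by (simp add: c_def s_def numeral_2_eq_2)
  qed
  have "cfrac_fin (Suc (Suc N)) a - t 0 = 1 / (b + 1 / c) - 1 / (b + 1 / s)"
    using ge2(4)[of 0] t1 by (simp add: b_def c_def)
  also have "\<dots> = c / (b * c + 1) - s / (b * s + 1)"
    using c s by (simp add: add_divide_eq_iff)
  also have "\<dots> = (c - s) / ((b * c + 1) * (b * s + 1))"
    using bc bs by (simp add: diff_frac_eq algebra_simps)
  finally have "\<bar>cfrac_fin (Suc (Suc N)) a - t 0\<bar> = \<bar>c - s\<bar> / ((b * c + 1) * (b * s + 1))"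
    using bc bs by (simp add: abs_mult)
  also have "\<dots> \<le> (1 / 2 ^ N) / (2 * 2)"
    using IH bc bs by (intro frac_le mult_mono) auto
  finally show ?case by simp
qed

lemma has_cfrac_valueI:
  fixes a :: "nat \<Rightarrow> int" and t :: "nat \<Rightarrow> real"
  assumes "\<And>i. i \<ge> 1 \<Longrightarrow> a i \<ge> 1"
    and "\<And>i. t i = of_int (a i) + 1 / t (Suc i)"
    and "\<And>i. i \<ge> 1 \<Longrightarrow> t i > 0"
  shows "has_cfrac_value a (t 0)"
proof -
  have "(\<lambda>N. cfrac_fin N a - t 0) \<longlonglongrightarrow> 0"
  proof (rule tendsto_0_le[where K = 1])
    show "(\<lambda>N. (1 / 2) ^ N :: real) \<longlonglongrightarrow> 0" by (rule LIMSEQ_realpow_zero) auto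
    show "\<forall>\<^sub>F N in sequentially. norm (cfrac_fin N a - t 0) \<le> norm ((1 / 2) ^ N :: real) * 1"
      using cfrac_fin_error[of a t, OF assms] by (auto simp: power_divide)
  qed
  then have "(\<lambda>N. cfrac_fin N a) \<longlonglongrightarrow> t 0" by (rule LIM_zero_cancel)
  moreover have "a i > 0" if "i \<ge> 1" for i using assms(1)[OF that] by simp
  ultimately show ?thesis unfolding has_cfrac_value_def by blast
qed

section \<open>Periodic continued fractions\<close>

text \<open>
  As a function of the last entry \<open>t\<close> this is a fractional linear map; the complete quotient at
  the start of a period is a positive fixed point of it.
\<close>
definition cfrac_tail :: "int list \<Rightarrow> real \<Rightarrow> real" where
  "cfrac_tail bs t = foldr (\<lambda>b s. of_int b + 1 / s) bs t"

lemma cfrac_tail_simps [simp]: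
  "cfrac_tail [] t = t"
  "cfrac_tail (b # bs) t = of_int b + 1 / cfrac_tail bs t"
  "cfrac_tail (bs @ cs) t = cfrac_tail bs (cfrac_tail cs t)"
  by (simp_all add: cfrac_tail_def)

lemma cfrac_tail_pos:
  assumes "\<forall>b\<in>set bs. b \<ge> 1" "t > 0"
  shows "cfrac_tail bs t > 0"
  using assms by (induction bs) (auto intro!: add_pos_pos)

text \<open>
  If $y$ is a fixed point of the substitution given by the block, then the complete quotients are
  the values of the final segments of the block, each continued by $y$; the fixed point equation is what
  makes them fit together at the end of a period.
\<close>
lemma has_cfrac_value_periodic:
  assumes "bs \<noteq> []" and pos: "\<forall>b\<in>set bs. b \<ge> 1" and "y > 0"
    and fixpoint: "cfrac_tail bs y = y"
  shows "has_cfrac_value (periodic_pq a0 bs) (of_int a0 + 1 / y)"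
proof -
  define l where "l = length bs"
  define T where "T i = cfrac_tail (drop (i mod l) bs) y" for i
  define t where "t i = (if i = 0 then of_int a0 + 1 / y else T (i - 1))" for i
  have l: "l > 0" using assms(1) by (simp add: l_def)
  have T0: "T 0 = y" using fixpoint by (simp add: T_def)
  have T_Suc: "T i = of_int (bs ! (i mod l)) + 1 / T (Suc i)" for i
  proof -
    have r: "i mod l < length bs" using l by (simp add: l_def)
    have "cfrac_tail (drop (Suc (i mod l)) bs) y = T (Suc i)"
      using T0 by (auto simp: T_def mod_Suc l_def)
    then show ?thesis
      unfolding T_def Cons_nth_drop_Suc[OF r, symmetric] by simp
  qed
  have T_pos: "T i > 0" for i
    unfolding T_def using pos assms(3) by (intro cfrac_tail_pos) (auto dest: in_set_dropD)
  have "has_cfrac_value (periodic_pq a0 bs) (t 0)"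
  proof (rule has_cfrac_valueI)
    show "periodic_pq a0 bs i \<ge> 1" if "i \<ge> 1" for i
      using that pos l by (simp add: periodic_pq_def l_def)
    show "t i = of_int (periodic_pq a0 bs i) + 1 / t (Suc i)" for i
      using T_Suc[of "i - 1"] T0 by (simp add: t_def periodic_pq_def l_def)
    show "t i > 0" if "i \<ge> 1" for i
      using that T_pos by (simp add: t_def)
  qed
  then show ?thesis by (simp add: t_def)
qed

section \<open>Continuants of a constant sequence\<close>

fun const_continuant :: "int \<Rightarrow> nat \<Rightarrow> int" where
  "const_continuant b 0 = 0"
| "const_continuant b (Suc 0) = 1"
| "const_continuant b (Suc (Suc j)) = b * const_continuant b (Suc j) + const_continuant b j"

lemma const_continuant_bounds:
  assumes "b \<ge> 1"
  shows "const_continuant b j \<ge> 0 \<and> const_continuant b (Suc j) \<ge> 1"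
proof (induction j)
  case (Suc j)
  then have "b * const_continuant b (Suc j) \<ge> 1"
    using assms mult_mono[of 1 b 1 "const_continuant b (Suc j)"] by simp
  with Suc show ?case by simp
qed simp

lemma cfrac_tail_replicate:
  fixes t :: real
  assumes "b \<ge> 1" "t > 0"
  defines "U \<equiv> \<lambda>j. real_of_int (const_continuant b j)"
  shows "cfrac_tail (replicate (Suc k) b) t =
    (U (Suc (Suc k)) * t + U (Suc k)) / (U (Suc k) * t + U k)"
proof (induction k)
  case 0
  show ?case using assms(2) by (simp add: U_def divide_simps)
next
  case (Suc k)
  have U: "U j \<ge> 0" "U (Suc j) \<ge> 1" for j
    using const_continuant_bounds[OF assms(1), of j] by (simp_all add: U_def)
  have pos: "U (Suc j) * t + U j > 0" for j
    using U[of j] assms(2) by (intro add_pos_nonneg mult_pos_pos) auto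
  have rec: "U (Suc (Suc j)) = of_int b * U (Suc j) + U j" for j
    by (simp add: U_def)
  have "cfrac_tail (replicate (Suc (Suc k)) b) t
      = of_int b + (U (Suc k) * t + U k) / (U (Suc (Suc k)) * t + U (Suc k))"
    unfolding replicate_Suc[of "Suc k"] cfrac_tail_simps Suc.IH by simp
  also have "\<dots> = (of_int b * (U (Suc (Suc k)) * t + U (Suc k)) + (U (Suc k) * t + U k))
                   / (U (Suc (Suc k)) * t + U (Suc k))"
    using pos[of "Suc k"] by (simp add: add_divide_distrib)
  also have "of_int b * (U (Suc (Suc k)) * t + U (Suc k)) + (U (Suc k) * t + U k)
      = U (Suc (Suc (Suc k))) * t + U (Suc (Suc k))"
    unfolding rec[of "Suc k"] rec[of k] by (simp add: algebra_simps)
  finally show ?case .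
qed

text \<open>
  The substitution $q_{2i} = U_{2i}/2$, $q_{2i+1} = U_{2i+1}$ turns the coefficients $m$ and $4m$
  into the constant coefficient $2m$. The sequence $U_{j-1} + m U_j$ also satisfies the constant
  recurrence, and $p$ arises from twice that sequence in the same way. The factors 2
  cancel in the ratio of $p$ and $q$, which therefore does not depend on the parity of $j$. The
  second conclusion supplies the sign of $q$.
\<close>
lemma convergents_continuants:
  fixes m :: int and p q :: "nat \<Rightarrow> int"
  assumes init: "p 0 = 1" "p 1 = 2 * m" "q 0 = 0" "q 1 = 1"
    and rec: "\<forall>j\<ge>1. p (2 * j) = m * p (2 * j - 1) + p (2 * j - 2)"
      "\<forall>j\<ge>1. p (2 * j + 1) = 4 * m * p (2 * j) + p (2 * j - 1)"
      "\<forall>j\<ge>1. q (2 * j) = m * q (2 * j - 1) + q (2 * j - 2)"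
      "\<forall>j\<ge>1. q (2 * j + 1) = 4 * m * q (2 * j) + q (2 * j - 1)"
  defines "U \<equiv> const_continuant (2 * m)"
  shows "p (Suc j) * U (Suc j) = 2 * q (Suc j) * (U j + m * U (Suc j))"
    and "q (Suc j) = U (Suc j) \<or> 2 * q (Suc j) = U (Suc j)"
proof -
  have even: "p (2*i+2) = m * p (2*i+1) + p (2*i)" "q (2*i+2) = m * q (2*i+1) + q (2*i)" for i
    using rec(1,3)[rule_format, of "Suc i"] by simp_all
  have odd: "p (2*i+3) = 4 * m * p (2*i+2) + p (2*i+1)"
    "q (2*i+3) = 4 * m * q (2*i+2) + q (2*i+1)" for i
    using rec(2,4)[rule_format, of "Suc i"] by (simp_all add: eval_nat_numeral)
  have U: "U (j+2) = 2 * m * U (j+1) + U j" for j by (simp add: U_def)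
  have inv: "q (2*i+1) = U (2*i+1) \<and> 2 * q (2*i+2) = U (2*i+2) \<and>
      p (2*i+1) = 2 * (U (2*i) + m * U (2*i+1)) \<and> p (2*i+2) = U (2*i+1) + m * U (2*i+2)" for i
  proof (induction i)
    case 0
    have "U 0 = 0" "U 1 = 1" by (simp_all add: U_def)
    then show ?case using init even[of 0] U[of 0] by (simp add: algebra_simps)
  next
    case (Suc i)
    have U3: "U (2*i+3) = 2 * m * U (2*i+2) + U (2*i+1)"
      using U[of "2*i+1"] by (simp add: eval_nat_numeral)
    have U4: "U (2*i+4) = 2 * m * U (2*i+3) + U (2*i+2)"
      using U[of "2*i+2"] by (simp add: eval_nat_numeral)
    have q3: "q (2*i+3) = U (2*i+3)"
      using Suc odd(2)[of i] U3 by (simp add: algebra_simps)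
    have p3: "p (2*i+3) = 2 * (U (2*i+2) + m * U (2*i+3))"
      using Suc odd(1)[of i] U3 U[of "2*i"] by (simp add: algebra_simps)
    have q4: "2 * q (2*i+4) = U (2*i+4)"
      using Suc even(2)[of "Suc i"] q3 U4 by (simp add: eval_nat_numeral)
    have "p (2*i+4) = m * p (2*i+3) + p (2*i+2)"
      using even(1)[of "Suc i"] by (simp add: eval_nat_numeral)
    then have p4: "p (2*i+4) = U (2*i+3) + m * U (2*i+4)"
      using Suc p3 U3 U4 by (simp add: algebra_simps)
    from q3 q4 p3 p4 show ?case by (simp add: eval_nat_numeral)
  qed
  have "p (Suc j) * U (Suc j) = 2 * q (Suc j) * (U j + m * U (Suc j))
      \<and> (q (Suc j) = U (Suc j) \<or> 2 * q (Suc j) = U (Suc j))"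
  proof (cases "even j")
    case True
    then obtain i where "j = 2 * i" by blast
    then show ?thesis using inv[of i] by simp
  next
    case False
    then obtain i where "j = 2 * i + 1" using oddE by blast
    then have "p (Suc j) = U j + m * U (Suc j)" "2 * q (Suc j) = U (Suc j)"
      using inv[of i] by simp_all
    then show ?thesis by simp
  qed
  then show "p (Suc j) * U (Suc j) = 2 * q (Suc j) * (U j + m * U (Suc j))"
    and "q (Suc j) = U (Suc j) \<or> 2 * q (Suc j) = U (Suc j)" by auto
qed

section \<open>The expansion of the square root\<close>

text \<open>
  The equation between integers is all that remains of the quadratic equation for $\sqrt N$.
  Writing $N - A^2 = (\sqrt N - A)(\sqrt N + A)$, it says that
  $1/(\sqrt N - A)$ is the image of $\sqrt N + A$ under the block of entries $b$. The
  block has $k + 1$ entries, so that no continuant with index $-1$ occurs.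
\<close>
lemma sqrt_cfrac_constant_block:
  fixes A N b :: int and k :: nat
  assumes "b \<ge> 1" "A \<ge> 1"
  defines "U \<equiv> const_continuant b"
  assumes eq: "U (Suc (Suc k)) * (N - A\<^sup>2) = 2 * A * U (Suc k) + U k"
  shows "has_cfrac_value (periodic_pq A (replicate (Suc k) b @ [2 * A])) (sqrt (of_int N))"
proof -
  define x where "x = sqrt (real_of_int N)"
  define y where "y = 1 / (x - of_int A)"
  define u v w where "u = real_of_int (U k)" and "v = real_of_int (U (Suc k))"
    and "w = real_of_int (U (Suc (Suc k)))"
  have bounds: "U k \<ge> 0" "U (Suc k) \<ge> 1" "U (Suc (Suc k)) \<ge> 1"
    using const_continuant_bounds[OF assms(1)] unfolding U_def by blast+
  have "2 * A * U (Suc k) + U k > 0"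
    using bounds assms(2) by (intro add_pos_nonneg mult_pos_pos) auto
  then have N: "N > A\<^sup>2"
    using bounds(3) by (simp add: eq[symmetric] zero_less_mult_iff)
  then have "real_of_int N > (of_int A)\<^sup>2"
    by (metis of_int_less_iff of_int_power)
  then have xA: "x > of_int A" unfolding x_def by (rule real_less_rsqrt)
  have "N \<ge> 0" using N zero_le_power2[of A] by linarith
  then have x2: "x\<^sup>2 = of_int N" by (simp add: x_def)
  have y: "y > 0" using xA by (simp add: y_def)
  have t: "x + of_int A > 0" using xA assms(2) by linarith
  have "real_of_int (U (Suc (Suc k)) * (N - A\<^sup>2)) = of_int (2 * A * U (Suc k) + U k)"
    using eq by simp
  then have "w * (x\<^sup>2 - (of_int A)\<^sup>2) = 2 * of_int A * v + u"
    by (simp add: x2 u_def v_def w_def)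
  then have key: "(x - of_int A) * (w * (x + of_int A) + v) = v * (x + of_int A) + u"
    by (simp add: algebra_simps power2_eq_square)
  have den: "v * (x + of_int A) + u > 0"
  proof (rule add_pos_nonneg)
    show "v * (x + of_int A) > 0" using bounds(2) t by (simp add: v_def)
    show "u \<ge> 0" using bounds(1) by (simp add: u_def)
  qed
  have "cfrac_tail (replicate (Suc k) b @ [2 * A]) y
      = cfrac_tail (replicate (Suc k) b) (x + of_int A)"
    by (simp add: y_def add.commute)
  also have "\<dots> = (w * (x + of_int A) + v) / (v * (x + of_int A) + u)"
    using cfrac_tail_replicate[OF assms(1) t, of k] by (simp only: u_def v_def w_def U_def)
  also have "\<dots> = y"
    using den key xA by (simp add: y_def frac_eq_eq mult.commute)
  finally have "cfrac_tail (replicate (Suc k) b @ [2 * A]) y = y" .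
  then have "has_cfrac_value (periodic_pq A (replicate (Suc k) b @ [2 * A])) (of_int A + 1 / y)"
    using y assms(1,2) by (intro has_cfrac_value_periodic) auto
  then show ?thesis by (simp add: y_def x_def)
qed

theorem mainTheorem6:
  fixes m n :: int and k :: nat and p q :: "nat \<Rightarrow> int"
  assumes "m \<ge> 1"
    and "p 0 = 1" and "p 1 = 2 * m" and "q 0 = 0" and "q 1 = 1"
    and "\<forall>j\<ge>1. p (2 * j) = m * p (2 * j - 1) + p (2 * j - 2)"
    and "\<forall>j\<ge>1. p (2 * j + 1) = 4 * m * p (2 * j) + p (2 * j - 1)"
    and "\<forall>j\<ge>1. q (2 * j) = m * q (2 * j - 1) + q (2 * j - 2)"
    and "\<forall>j\<ge>1. q (2 * j + 1) = 4 * m * q (2 * j) + q (2 * j - 1)"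
    and "k \<ge> 1" and "n \<ge> 1"
  shows "has_cfrac_value
           (periodic_pq (q (k + 1) * n + m)
              (replicate k (2 * m) @ [2 * (q (k + 1) * n + m)]))
           (sqrt (of_int ((q (k + 1) * n)\<^sup>2 + p (k + 1) * n + m\<^sup>2 + 1)))"
proof -
  define U where "U = const_continuant (2 * m)"
  define A where "A = q (k + 1) * n + m"
  define N where "N = (q (k + 1) * n)\<^sup>2 + p (k + 1) * n + m\<^sup>2 + 1"
  obtain l where k: "k = Suc l" using \<open>k \<ge> 1\<close> by (cases k) auto
  have pq: "p (k + 1) * U (k + 1) = 2 * q (k + 1) * (U k + m * U (k + 1))"
    using convergents_continuants(1)[OF assms(2-9), of k] by (simp add: U_def)
  have U: "U (k + 1) = 2 * m * U k + U l" by (simp add: k U_def)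
  have "2 * m \<ge> 1" using \<open>m \<ge> 1\<close> by simp
  then have "U (k + 1) \<ge> 1"
    using const_continuant_bounds[of "2 * m" k] unfolding U_def by simp
  have "q (k + 1) \<ge> 0"
    using convergents_continuants(2)[OF assms(2-9), of k] \<open>U (k + 1) \<ge> 1\<close> by (auto simp: U_def)
  have "A \<ge> 1" using \<open>q (k + 1) \<ge> 0\<close> \<open>m \<ge> 1\<close> \<open>n \<ge> 1\<close> by (simp add: A_def add_increasing)
  have "U (k + 1) * (N - A\<^sup>2) =
      (p (k + 1) * U (k + 1) - 2 * m * q (k + 1) * U (k + 1)) * n + U (k + 1)"
    by (simp add: N_def A_def algebra_simps power2_eq_square)
  also have "\<dots> = 2 * q (k + 1) * U k * n + (2 * m * U k + U l)"
    unfolding pq using U by (simp add: algebra_simps)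
  also have "\<dots> = 2 * A * U k + U l"
    by (simp add: A_def algebra_simps)
  finally have "has_cfrac_value (periodic_pq A (replicate k (2 * m) @ [2 * A])) (sqrt (of_int N))"
    using sqrt_cfrac_constant_block[of "2 * m" A l N] \<open>m \<ge> 1\<close> \<open>A \<ge> 1\<close> by (simp add: k U_def)
  then show ?thesis by (simp add: A_def N_def)
qed

end
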